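(* Let $\mathcal{H}$ be a complex Hilbert space, let $A\in\mathcal{B}(\mathcal{H})$ be positive (semi-definite), let $\mathbb{A}=\begin{pmatrix}A&0\\0&A\end{pmatrix}$, and let $\mathbb{T}=\begin{pmatrix}P&Q\\R&S\end{pmatrix}$ with $P,Q,R,S\in\mathcal{B}_{A}(\mathcal{H})$. Then $$\omega_{\mathbb{A}}(\mathbb{T})\le\frac12\left(\|P\|_A+\|S\|_A+\|PP^{\sharp_A}+QQ^{\sharp_A}\|_A^{1/2}+\|RR^{\sharp_A}+SS^{\sharp_A}\|_A^{1/2}\right).$$
   Context: $\mathcal{B}(\mathcal{H})$ is the algebra of bounded linear operators on $\mathcal{H}$. The positive semi-definite operator $A$ induces the semi-inner product $\langle x\mid y\rangle_A=\langle Ax\mid y\rangle$ and the seminorm $\|x\|_A=\langle x\mid x\rangle_A^{1/2}=\|A^{1/2}x\|$. An operator $T\in\mathcal{B}(\mathcal{H})$ is $A$-bounded if there is $\lambda>0$ with $\|Tx\|_A\le\lambda\|x\|_A$ for all $x\in\mathcal{H}$; then $\|T\|_A=\sup\{\|Tx\|_A : x\in\mathcal{H},\ \|x\|_A=1\}$. The $A$-numerical radius is $\omega_A(T)=\sup\{|\langle Tx\mid x\rangle_A| : x\in\mathcal{H},\ \|x\|_A=1\}$. $\mathcal{B}_A(\mathcal{H})$ is the set of $T\in\mathcal{B}(\mathcal{H})$ with $\mathcal{R}(T^*A)\subseteq\mathcal{R}(A)$ ($\mathcal{R}$ denotes range), equivalently those admitting an $A$-adjoint, i.e. a bounded $X$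 with $AX=T^*A$; all such $T$ are $A$-bounded. For $T\in\mathcal{B}_A(\mathcal{H})$, $T^{\sharp_A}$ is the unique bounded solution $X$ of $AX=T^*A$ with $\mathcal{R}(X)\subseteq\overline{\mathcal{R}(A)}$. The operator $\mathbb{A}$ is a positive operator on $\mathcal{H}\oplus\mathcal{H}$, with $\langle x,y\rangle_{\mathbb{A}}=\langle x_1\mid y_1\rangle_A+\langle x_2\mid y_2\rangle_A$ for $x=(x_1,x_2)$, $y=(y_1,y_2)$; $\|\cdot\|_{\mathbb{A}}$ and $\omega_{\mathbb{A}}$ are defined in the same way with $(\mathcal{H}\oplus\mathcal{H},\mathbb{A})$ in place of $(\mathcal{H},A)$. A $2\times2$ matrix of operators on $\mathcal{H}$ denotes the corresponding operator on $\mathcal{H}\oplus\mathcal{H}$. *)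

theory Defs
  imports "HOL-Analysis.Analysis"
begin

text \<open>Inner products are linear in the first argument and conjugate-linear in the second.\<close>

class complex_inner = real_normed_vector +
  fixes scaleC :: "complex \<Rightarrow> 'a \<Rightarrow> 'a" (infixr "*\<^sub>C" 75)
    and cinner :: "'a \<Rightarrow> 'a \<Rightarrow> complex"
  assumes scaleC_add_right: "c *\<^sub>C (x + y) = c *\<^sub>C x + c *\<^sub>C y"
    and scaleC_add_left: "(c + d) *\<^sub>C x = c *\<^sub>C x + d *\<^sub>C x"
    and scaleC_scaleC: "c *\<^sub>C d *\<^sub>C x = (c * d) *\<^sub>C x"
    and scaleC_one: "1 *\<^sub>C x = x"
    and scaleC_of_real: "complex_of_real r *\<^sub>C x = r *\<^sub>R x"
    and cinner_commute: "cinner x y = cnj (cinner y x)"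
    and cinner_add_left: "cinner (x + y) z = cinner x z + cinner y z"
    and cinner_scaleC_left: "cinner (c *\<^sub>C x) y = c * cinner x y"
    and cinner_self_nonneg: "cinner x x \<in> \<real>\<^sub>\<ge>\<^sub>0"
    and cinner_eq_zero_iff: "cinner x x = 0 \<longleftrightarrow> x = 0"
    and norm_eq_sqrt_cinner: "norm x = sqrt (Re (cinner x x))"

class complex_hilbert = complex_inner + complete_space

instantiation complex :: complex_hilbert
begin

definition scaleC_complex :: "complex \<Rightarrow> complex \<Rightarrow> complex"
  where "c *\<^sub>C x = c * x"

definition cinner_complex :: "complex \<Rightarrow> complex \<Rightarrow> complex"
  where "cinner x y = x * cnj y"

instance
  by standard
    (auto simp: scaleC_complex_def cinner_complex_def algebra_simps scaleR_conv_of_real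
      complex_nonneg_Reals_iff cmod_def power2_eq_square)

end

text \<open>The Hilbert direct sum is the product type; its library norm is the one induced by
  the inner product below.\<close>

instantiation prod :: (complex_inner, complex_inner) complex_inner
begin

definition scaleC_prod :: "complex \<Rightarrow> 'a \<times> 'b \<Rightarrow> 'a \<times> 'b"
  where "c *\<^sub>C x = (c *\<^sub>C fst x, c *\<^sub>C snd x)"

definition cinner_prod :: "'a \<times> 'b \<Rightarrow> 'a \<times> 'b \<Rightarrow> complex"
  where "cinner x y = cinner (fst x) (fst y) + cinner (snd x) (snd y)"

instance
proof
  fix x y z :: "'a \<times> 'b" and c d :: complex and r :: real
  show "c *\<^sub>C (x + y) = c *\<^sub>C x + c *\<^sub>C y" "(c + d) *\<^sub>C x = c *\<^sub>C x + d *\<^sub>C x"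
    "c *\<^sub>C d *\<^sub>C x = (c * d) *\<^sub>C x" "1 *\<^sub>C x = x" "complex_of_real r *\<^sub>C x = r *\<^sub>R x"
    by (simp_all add: scaleC_prod_def scaleC_add_right scaleC_add_left scaleC_scaleC scaleC_one
        scaleC_of_real scaleR_prod_def)
  show "cinner x y = cnj (cinner y x)"
    unfolding cinner_prod_def
    by (metis cinner_commute complex_cnj_add)
  show "cinner (x + y) z = cinner x z + cinner y z" "cinner (c *\<^sub>C x) y = c * cinner x y"
    by (simp_all add: cinner_prod_def scaleC_prod_def cinner_add_left cinner_scaleC_left
        algebra_simps)
  have nonneg: "0 \<le> Re (cinner u u) \<and> Im (cinner u u) = 0" for u :: "'c::complex_inner"
    using cinner_self_nonneg[of u] by (simp add: complex_nonneg_Reals_iff)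
  show "cinner x x \<in> \<real>\<^sub>\<ge>\<^sub>0"
    using nonneg[of "fst x"] nonneg[of "snd x"]
    by (simp add: cinner_prod_def complex_nonneg_Reals_iff)
  show norm: "norm x = sqrt (Re (cinner x x))"
    using nonneg[of "fst x"] nonneg[of "snd x"]
    by (simp add: norm_prod_def cinner_prod_def norm_eq_sqrt_cinner)
  show "cinner x x = 0 \<longleftrightarrow> x = 0"
  proof
    assume "cinner x x = 0"
    then have "norm x = 0" by (simp add: norm)
    then show "x = 0" by simp
  next
    assume "x = 0"
    then show "cinner x x = 0" by (simp add: cinner_prod_def cinner_eq_zero_iff[THEN iffD2])
  qed
qed

end

instance prod :: (complex_hilbert, complex_hilbert) complex_hilbert ..

definition bounded_clinear :: "('a::complex_inner \<Rightarrow> 'b::complex_inner) \<Rightarrow> bool"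
  where "bounded_clinear T \<longleftrightarrow> bounded_linear T \<and> (\<forall>c x. T (c *\<^sub>C x) = c *\<^sub>C T x)"

definition hilbert_adjoint :: "('a::complex_hilbert \<Rightarrow> 'a) \<Rightarrow> 'a \<Rightarrow> 'a"
  where "hilbert_adjoint T =
    (THE S. bounded_clinear S \<and> (\<forall>x y. cinner (T x) y = cinner x (S y)))"

definition positive_op :: "('a::complex_hilbert \<Rightarrow> 'a) \<Rightarrow> bool"
  where "positive_op A \<longleftrightarrow> bounded_clinear A \<and> (\<forall>x. cinner (A x) x \<in> \<real>\<^sub>\<ge>\<^sub>0)"

definition A_inner :: "('a::complex_hilbert \<Rightarrow> 'a) \<Rightarrow> 'a \<Rightarrow> 'a \<Rightarrow> complex"
  where "A_inner A x y = cinner (A x) y"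

definition A_seminorm :: "('a::complex_hilbert \<Rightarrow> 'a) \<Rightarrow> 'a \<Rightarrow> real"
  where "A_seminorm A x = sqrt (Re (A_inner A x x))"

text \<open>Both suprema are taken in the nonnegative reals: inserting \<open>0\<close> changes them only when no
  vector has \<open>A\<close>-seminorm \<open>1\<close>, i.e. for \<open>A = 0\<close>, where it makes the empty supremum \<open>0\<close>
  (\<open>Sup {}\<close> is unspecified on the reals). They are meaningful for \<open>A\<close>-bounded operators only.\<close>

definition A_opnorm :: "('a::complex_hilbert \<Rightarrow> 'a) \<Rightarrow> ('a \<Rightarrow> 'a) \<Rightarrow> real"
  where "A_opnorm A T = Sup (insert 0 {A_seminorm A (T x) | x. A_seminorm A x = 1})"

definition A_numerical_radius :: "('a::complex_hilbert \<Rightarrow> 'a) \<Rightarrow> ('a \<Rightarrow> 'a) \<Rightarrow> real"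
  where "A_numerical_radius A T =
    Sup (insert 0 {cmod (A_inner A (T x) x) | x. A_seminorm A x = 1})"

definition A_adjointable :: "('a::complex_hilbert \<Rightarrow> 'a) \<Rightarrow> ('a \<Rightarrow> 'a) set"
  where "A_adjointable A =
    {T. bounded_clinear T \<and> range (hilbert_adjoint T \<circ> A) \<subseteq> range A}"

definition A_sharp :: "('a::complex_hilbert \<Rightarrow> 'a) \<Rightarrow> ('a \<Rightarrow> 'a) \<Rightarrow> 'a \<Rightarrow> 'a"
  where "A_sharp A T =
    (THE X. bounded_clinear X \<and> A \<circ> X = hilbert_adjoint T \<circ> A
      \<and> range X \<subseteq> closure (range A))"

definition op_matrix ::
    "('a::complex_hilbert \<Rightarrow> 'a) \<Rightarrow> ('a \<Rightarrow> 'a) \<Rightarrow> ('a \<Rightarrow> 'a) \<Rightarrow> ('a \<Rightarrow> 'a) \<Rightarrow> 'a \<times> 'a \<Rightarrow> 'a \<times> 'a"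
  where "op_matrix P Q R S = (\<lambda>(x, y). (P x + Q y, R x + S y))"

end

theory Submission
  imports Defs
begin

text \<open>Write \<open>\<langle>\<cdot>, \<cdot>\<rangle>\<close> and \<open>\<parallel>\<cdot>\<parallel>\<close> for the semi-inner product and the seminorm induced by \<open>A\<close>, and \<open>T'\<close> for the
adjoint of \<open>T\<close> with respect to it. The inequality is a sum of two estimates, one for each row of
the matrix. For a pair \<open>(u, v)\<close> with \<open>\<parallel>u\<parallel>\<^sup>2 + \<parallel>v\<parallel>\<^sup>2 = 1\<close>, the quadratic form of the matrix is
\<open>\<langle>P u + Q v, u\<rangle> + \<langle>R u + S v, v\<rangle>\<close>, and the first summand has modulus at most \<open>p \<parallel>u\<parallel>\<^sup>2 + q \<parallel>u\<parallel> \<parallel>v\<parallel>\<close>, where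
\<open>p = |\<langle>P u, u\<rangle>| / \<parallel>u\<parallel>\<^sup>2\<close> and \<open>q = \<parallel>Q' u\<parallel> / \<parallel>u\<parallel>\<close>. The largest value of this quadratic form on the unit circle is
\<open>(p + sqrt (p\<^sup>2 + q\<^sup>2)) / 2\<close>. Now \<open>p \<le> \<parallel>P\<parallel>\<close>, and also \<open>p \<le> \<parallel>P' u\<parallel> / \<parallel>u\<parallel>\<close>, so that
\<open>p\<^sup>2 + q\<^sup>2 \<le> \<langle>(P P' + Q Q') u, u\<rangle> / \<parallel>u\<parallel>\<^sup>2 \<le> \<parallel>P P' + Q Q'\<parallel>\<close>. When \<open>\<parallel>u\<parallel> = 0\<close> the first
summand vanishes by the Cauchy--Schwarz inequality. This is \<open>row_numerical_bound\<close>; the second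
summand is treated alike with the roles of \<open>u\<close> and \<open>v\<close> exchanged.

The rest supplies the objects that occur in this computation. The Hilbert adjoint and the
distinguished adjoint \<open>A_sharp\<close> are definite descriptions, so both must be shown to exist and to be
unique. The former rests on orthogonal projection and the Riesz representation
(\<open>Riesz_representation\<close>), the latter on projecting onto the closure of the range of \<open>A\<close> and on the
uniform boundedness principle (\<open>A_sharp_exists\<close>). Finally, the operator seminorms are suprema of
reals and carry information only for operators bounded in the seminorm; having an adjoint for the
form implies this (\<open>adjoint_pair_bounded\<close>).\<close>

section \<open>Positive semidefinite sesquilinear forms\<close>

locale semi_inner =
  fixes s :: "'a::complex_inner \<Rightarrow> 'a \<Rightarrow> complex"
  assumes add_left: "s (x + y) z = s x z + s y z"
    and scale_left: "s (c *\<^sub>C x) y = c * s x y"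
    and commute: "s x y = cnj (s y x)"
    and nonneg: "0 \<le> Re (s x x)"
begin

definition seminorm :: "'a \<Rightarrow> real"
  where "seminorm x = sqrt (Re (s x x))"

lemma add_right: "s x (y + z) = s x y + s x z"
  by (metis add_left commute complex_cnj_add)

lemma scale_right: "s x (c *\<^sub>C y) = cnj c * s x y"
  by (metis commute complex_cnj_mult scale_left)

lemma minus_left: "s (- x) y = - s x y"
  by (metis add.right_inverse add_left add_right_imp_eq eq_neg_iff_add_eq_0 add_0)

lemma minus_right: "s x (- y) = - s x y"
  by (metis minus_left commute complex_cnj_minus)

lemma diff_left: "s (x - y) z = s x z - s y z"
  by (metis add_left minus_left diff_conv_add_uminus)

lemma diff_right: "s x (y - z) = s x y - s x z"
  by (metis add_right minus_right diff_conv_add_uminus)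

lemma zero_left [simp]: "s 0 y = 0"
  using diff_left[of 0 0 y] by simp

lemma zero_right [simp]: "s x 0 = 0"
  using diff_right[of x 0 0] by simp

lemma Im_self [simp]: "Im (s x x) = 0"
  by (metis commute cnj.simps(2) neg_equal_zero)

lemma seminorm_nonneg [simp]: "0 \<le> seminorm x"
  by (simp add: seminorm_def nonneg)

lemma seminorm_power2: "(seminorm x)\<^sup>2 = Re (s x x)"
  by (simp add: seminorm_def nonneg)

lemma self_eq: "s x x = complex_of_real ((seminorm x)\<^sup>2)"
  by (simp add: seminorm_power2 complex_eq_iff)

lemma seminorm_scale: "seminorm (c *\<^sub>C x) = cmod c * seminorm x"
proof -
  have "s (c *\<^sub>C x) (c *\<^sub>C x) = complex_of_real ((cmod c * seminorm x)\<^sup>2)"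
    using complex_norm_square[of c]
    by (simp add: scale_left scale_right self_eq[of x] power_mult_distrib mult.assoc[symmetric])
  then show ?thesis
    by (simp add: seminorm_def[of "c *\<^sub>C x"])
qed

lemma seminorm_scaleR: "seminorm (r *\<^sub>R x) = \<bar>r\<bar> * seminorm x"
  by (metis scaleC_of_real seminorm_scale norm_of_real)

lemma seminorm_diff_power2: "(seminorm (x - y))\<^sup>2 = (seminorm x)\<^sup>2 - 2 * Re (s y x) + (seminorm y)\<^sup>2"
proof -
  have "Re (s x y) = Re (s y x)"
    by (metis commute cnj.simps(1))
  then show ?thesis
    by (simp add: seminorm_power2 diff_left diff_right)
qed

lemma Cauchy_Schwarz: "cmod (s x y) \<le> seminorm x * seminorm y"
proof -
  define \<alpha> where "\<alpha> = (cmod (s x y))\<^sup>2"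
  have main: "0 \<le> (seminorm x)\<^sup>2 - 2 * t * \<alpha> + t\<^sup>2 * \<alpha> * (seminorm y)\<^sup>2" for t
  proof -
    define c where "c = complex_of_real t * s x y"
    have "s (c *\<^sub>C y) x = complex_of_real (t * \<alpha>)"
      using complex_norm_square[of "s x y"] commute[of y x]
      by (simp add: c_def scale_left \<alpha>_def)
    moreover have "(seminorm (c *\<^sub>C y))\<^sup>2 = t\<^sup>2 * \<alpha> * (seminorm y)\<^sup>2"
      by (simp add: seminorm_scale c_def \<alpha>_def norm_mult power_mult_distrib)
    ultimately show ?thesis
      using seminorm_diff_power2[of x "c *\<^sub>C y"] zero_le_power2[of "seminorm (x - c *\<^sub>C y)"] by simp
  qed
  have "\<alpha> \<le> (seminorm x)\<^sup>2 * (seminorm y)\<^sup>2"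
  proof (cases "seminorm y = 0")
    case True
    \<comment> \<open>The polynomial in \<open>t\<close> is now affine, and nonnegative everywhere only with slope \<open>0\<close>.\<close>
    have "\<alpha> = 0"
    proof (rule ccontr)
      assume "\<alpha> \<noteq> 0"
      then show False
        using main[of "((seminorm x)\<^sup>2 + 1) / \<alpha>"] True zero_le_power2[of "seminorm x"] by simp
    qed
    then show ?thesis by simp
  next
    case False
    then have "(1 / (seminorm y)\<^sup>2)\<^sup>2 * \<alpha> * (seminorm y)\<^sup>2 = \<alpha> / (seminorm y)\<^sup>2"
      by (simp add: power2_eq_square)
    then have "0 \<le> (seminorm x)\<^sup>2 - \<alpha> / (seminorm y)\<^sup>2"
      using main[of "1 / (seminorm y)\<^sup>2"] by simp
    then show ?thesis
      using False by (simp add: field_simps)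
  qed
  then have "(cmod (s x y))\<^sup>2 \<le> (seminorm x * seminorm y)\<^sup>2"
    by (simp add: \<alpha>_def power_mult_distrib)
  then show ?thesis
    by (rule power2_le_imp_le) simp
qed

text \<open>An operator seminorm is a supremum over vectors of seminorm \<open>1\<close> only. Rescaling carries a bound
over to all vectors of positive seminorm; a degenerate form also has nonzero vectors of seminorm \<open>0\<close>,
and these have to be controlled separately.\<close>

lemma le_by_homogeneity:
  fixes T :: "'a \<Rightarrow> 'a"
  assumes scaleR: "\<And>r x. T (r *\<^sub>R x) = r *\<^sub>R T x"
    and unit: "\<And>x. seminorm x = 1 \<Longrightarrow> seminorm (T x) \<le> K"
    and null: "\<And>x. seminorm x = 0 \<Longrightarrow> seminorm (T x) = 0"
  shows "seminorm (T x) \<le> K * seminorm x"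
proof (cases "seminorm x = 0")
  case True
  then show ?thesis by (simp add: null)
next
  case False
  have pos: "0 < seminorm x"
    using False seminorm_nonneg[of x] by linarith
  have "seminorm (T ((1 / seminorm x) *\<^sub>R x)) \<le> K"
    by (rule unit) (use pos in \<open>simp add: seminorm_scaleR\<close>)
  then show ?thesis
    using pos by (simp add: scaleR seminorm_scaleR field_simps)
qed

text \<open>An adjoint for the form alone forces boundedness for its seminorm. The operator \<open>B = T' T\<close> is
symmetric, so on a unit vector \<open>x\<close> the Cauchy--Schwarz inequality gives
\<open>\<parallel>B\<^sup>n x\<parallel>\<^sup>2 \<le> \<parallel>B\<^sup>2\<^sup>n x\<parallel>\<close> in the seminorm, and repeated doubling makes
\<open>\<parallel>B x\<parallel> ^ (2 ^ k)\<close> at most the seminorm of \<open>B ^ (2 ^ k) x\<close>. The latter is controlled by the norm of the space and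
grows at most like \<open>K ^ (2 ^ k)\<close>, where \<open>K\<close> bounds \<open>B\<close> for that norm. Hence \<open>\<parallel>B x\<parallel> \<le> K\<close>, and \<open>T\<close> is
bounded because \<open>\<parallel>T x\<parallel>\<^sup>2 = s x (B x)\<close>.\<close>

lemma adjoint_pair_bounded:
  fixes T T' :: "'a \<Rightarrow> 'a"
  assumes adj: "\<And>x y. s (T x) y = s x (T' y)"
    and "bounded_linear T" "bounded_linear T'"
    and seminorm_le: "\<And>x. seminorm x \<le> c * norm x"
  shows "\<exists>K\<ge>0. \<forall>x. seminorm (T x) \<le> K * seminorm x"
proof -
  define B where "B = T' \<circ> T"
  interpret T: bounded_linear T by fact
  interpret T': bounded_linear T' by fact
  have adj': "s (T' x) y = s x (T y)" for x y
    by (metis adj commute)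
  have B_step: "s (B x) y = s x (B y)" for x y
    by (simp add: B_def adj adj')
  have B_adj: "s ((B ^^ n) x) y = s x ((B ^^ n) y)" for n x y
    by (induction n arbitrary: x y) (simp_all add: B_step funpow_swap1)
  have "bounded_linear B"
    unfolding B_def comp_def
    by (rule bounded_linear_compose) (fact assms)+
  then obtain K where K: "0 < K" "\<And>x. norm (B x) \<le> norm x * K"
    using bounded_linear.pos_bounded by blast
  have B_pow: "norm ((B ^^ n) x) \<le> K ^ n * norm x" for n x
  proof (induction n)
    case (Suc n)
    have "norm ((B ^^ Suc n) x) \<le> norm ((B ^^ n) x) * K"
      using K by simp
    also have "\<dots> \<le> (K ^ n * norm x) * K"
      using Suc K by (intro mult_right_mono) auto
    finally show ?case by (simp add: algebra_simps)
  qed simp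
  have unit: "seminorm (B x) \<le> K" if x: "seminorm x = 1" for x
  proof (rule ccontr)
    assume "\<not> seminorm (B x) \<le> K"
    then have "1 < seminorm (B x) / K"
      using K by simp
    have sq: "(seminorm ((B ^^ n) x))\<^sup>2 \<le> seminorm ((B ^^ (2 * n)) x)" for n
    proof -
      have "(seminorm ((B ^^ n) x))\<^sup>2 = Re (s x ((B ^^ (2 * n)) x))"
        by (simp add: seminorm_power2 B_adj mult_2 funpow_add)
      also have "\<dots> \<le> cmod (s x ((B ^^ (2 * n)) x))"
        by (rule complex_Re_le_cmod)
      also have "\<dots> \<le> seminorm ((B ^^ (2 * n)) x)"
        using Cauchy_Schwarz[of x "(B ^^ (2 * n)) x"] x by simp
      finally show ?thesis .
    qed
    have iter: "seminorm (B x) ^ (2 ^ k) \<le> seminorm ((B ^^ (2 ^ k)) x)" for k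
    proof (induction k)
      case (Suc k)
      have "seminorm (B x) ^ (2 ^ Suc k) = (seminorm (B x) ^ (2 ^ k))\<^sup>2"
        by (simp add: power_even_eq)
      also have "\<dots> \<le> (seminorm ((B ^^ (2 ^ k)) x))\<^sup>2"
        using Suc by (intro power_mono) auto
      also have "\<dots> \<le> seminorm ((B ^^ (2 ^ Suc k)) x)"
        using sq[of "2 ^ k"] by simp
      finally show ?case .
    qed simp
    have ratio: "(seminorm (B x) / K) ^ (2 ^ k) \<le> \<bar>c\<bar> * norm x" for k
    proof -
      have "seminorm (B x) ^ (2 ^ k) \<le> c * norm ((B ^^ (2 ^ k)) x)"
        using iter seminorm_le by (rule order_trans)
      also have "\<dots> \<le> \<bar>c\<bar> * norm ((B ^^ (2 ^ k)) x)"
        by (intro mult_right_mono) auto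
      also have "\<dots> \<le> \<bar>c\<bar> * (K ^ (2 ^ k) * norm x)"
        using B_pow by (intro mult_left_mono) auto
      finally show ?thesis
        using K by (simp add: power_divide field_simps)
    qed
    obtain n where n: "\<bar>c\<bar> * norm x < (seminorm (B x) / K) ^ n"
      using real_arch_pow[OF \<open>1 < seminorm (B x) / K\<close>] by blast
    also have "\<dots> \<le> (seminorm (B x) / K) ^ (2 ^ n)"
      using \<open>1 < seminorm (B x) / K\<close> by (intro power_increasing) (auto intro: less_imp_le less_exp)
    also have "\<dots> \<le> \<bar>c\<bar> * norm x"
      by (rule ratio)
    finally show False by simp
  qed
  have T_sq: "(seminorm (T x))\<^sup>2 \<le> seminorm x * seminorm (B x)" for x
    using Cauchy_Schwarz[of x "B x"] complex_Re_le_cmod[of "s x (B x)"]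
    by (simp add: seminorm_power2 adj B_def)
  have "seminorm (T x) \<le> sqrt K * seminorm x" for x
  proof (rule le_by_homogeneity)
    fix x assume "seminorm x = 1"
    then show "seminorm (T x) \<le> sqrt K"
      using T_sq[of x] unit[of x] by (intro real_le_rsqrt) simp
  next
    fix x assume "seminorm x = 0"
    then show "seminorm (T x) = 0"
      using T_sq[of x] by simp
  qed (rule T.scaleR)
  then show ?thesis
    using K by (intro exI[of _ "sqrt K"]) simp
qed

end

section \<open>Orthogonal projection, Riesz representation and adjoints\<close>

interpretation cinner: semi_inner cinner
proof
  show "0 \<le> Re (cinner x x)" for x :: 'a
    using cinner_self_nonneg[of x] by (simp add: complex_nonneg_Reals_iff)
qed (rule cinner_add_left cinner_scaleC_left cinner_commute)+

lemma seminorm_cinner [simp]: "cinner.seminorm = norm"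
  by (rule ext) (simp add: cinner.seminorm_def norm_eq_sqrt_cinner)

lemma cinner_self_norm: "cinner x x = complex_of_real ((norm x)\<^sup>2)"
  using cinner.self_eq[of x] by simp

lemma norm_scaleC: "norm (c *\<^sub>C x) = cmod c * norm x"
  using cinner.seminorm_scale[of c x] by simp

lemma cinner_Cauchy_Schwarz: "cmod (cinner x y) \<le> norm x * norm y"
  using cinner.Cauchy_Schwarz[of x y] by simp

lemma minus_eq_scaleC: "- x = (- 1) *\<^sub>C (x :: 'a::complex_inner)"
  using scaleC_of_real[of "- 1" x] by simp

lemma cinner_eqI: "u = v" if "\<And>x. cinner x u = cinner x v"
  using that[of "u - v"] cinner_eq_zero_iff[of "u - v"] by (simp add: cinner.diff_right)

lemma bounded_linear_cinner_left: "bounded_linear (\<lambda>x. cinner x y)"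
proof (rule bounded_linear_intro[where K = "norm y"])
  show "cinner (r *\<^sub>R x) y = r *\<^sub>R cinner x y" for r x
    by (metis scaleC_of_real cinner_scaleC_left scaleR_conv_of_real)
qed (rule cinner_add_left cinner_Cauchy_Schwarz)+

lemma bounded_linear_cinner_right: "bounded_linear (\<lambda>y. cinner x y)"
proof -
  have "bounded_linear (\<lambda>y. cnj (cinner y x))"
    by (rule bounded_linear_compose[OF bounded_linear_cnj bounded_linear_cinner_left])
  then show ?thesis
    by (simp add: cinner_commute[of x])
qed

lemma bounded_clinear_zero: "bounded_clinear T \<Longrightarrow> T 0 = 0"
  and bounded_clinear_add: "bounded_clinear T \<Longrightarrow> T (x + y) = T x + T y"
  and bounded_clinear_diff: "bounded_clinear T \<Longrightarrow> T (x - y) = T x - T y"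
  and bounded_clinear_scaleC: "bounded_clinear T \<Longrightarrow> T (c *\<^sub>C x) = c *\<^sub>C T x"
  and bounded_clinear_bounded_linear: "bounded_clinear T \<Longrightarrow> bounded_linear T"
  unfolding bounded_clinear_def
  by (auto simp: linear_simps)

lemma bounded_clinearI:
  assumes add: "\<And>x y. T (x + y) = T x + T y"
    and scaleC: "\<And>c x. T (c *\<^sub>C x) = c *\<^sub>C T x"
    and bound: "\<And>x. norm (T x) \<le> norm x * K"
  shows "bounded_clinear T"
  unfolding bounded_clinear_def
proof (intro conjI allI scaleC)
  show "bounded_linear T"
    by (rule bounded_linear_intro[OF add _ bound])
      (simp add: scaleC_of_real[symmetric] scaleC)
qed

text \<open>The complex analogue of \<open>subspace\<close>, whose scalars are real.\<close>

definition csubspace :: "'a::complex_inner set \<Rightarrow> bool"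
  where "csubspace M \<longleftrightarrow>
    0 \<in> M \<and> (\<forall>x\<in>M. \<forall>y\<in>M. x + y \<in> M) \<and> (\<forall>c. \<forall>x\<in>M. c *\<^sub>C x \<in> M)"

lemma csubspace_diff: "csubspace M \<Longrightarrow> x \<in> M \<Longrightarrow> y \<in> M \<Longrightarrow> x - y \<in> M"
  unfolding csubspace_def by (metis diff_conv_add_uminus minus_eq_scaleC)

lemma parallelogram:
  "(norm (u - v))\<^sup>2 + (norm (u + v))\<^sup>2 = 2 * (norm u)\<^sup>2 + 2 * (norm (v :: 'a::complex_inner))\<^sup>2"
  using cinner.seminorm_diff_power2[of u v] cinner.seminorm_diff_power2[of u "- v"]
  by (simp add: cinner.minus_left)

text \<open>Moving \<open>w\<close> by a small multiple of its component along \<open>z\<close> would shorten it. The step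
\<open>t = 1 / (1 + \<parallel>z\<parallel>\<^sup>2)\<close> is small enough for the first-order gain to beat the quadratic loss, also
when \<open>z = 0\<close>.\<close>

lemma orthogonal_if_nearest:
  fixes w z :: "'a::complex_inner"
  assumes "\<And>c. norm w \<le> norm (w - c *\<^sub>C z)"
  shows "cinner z w = 0"
proof -
  define \<alpha> t where "\<alpha> = (cmod (cinner z w))\<^sup>2" and "t = 1 / (1 + (norm z)\<^sup>2)"
  define c where "c = complex_of_real t * cnj (cinner z w)"
  have pos: "0 < 1 + (norm z)\<^sup>2"
    by (intro add_pos_nonneg) auto
  have "cinner (c *\<^sub>C z) w = complex_of_real (t * \<alpha>)"
    using complex_norm_square[of "cinner z w"]
    by (simp add: c_def cinner_scaleC_left \<alpha>_def mult.commute)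
  moreover have "(norm (c *\<^sub>C z))\<^sup>2 = t\<^sup>2 * \<alpha> * (norm z)\<^sup>2"
    by (simp add: norm_scaleC c_def \<alpha>_def norm_mult power_mult_distrib)
  ultimately have "(norm (w - c *\<^sub>C z))\<^sup>2 = (norm w)\<^sup>2 - 2 * t * \<alpha> + t\<^sup>2 * \<alpha> * (norm z)\<^sup>2"
    using cinner.seminorm_diff_power2[of w "c *\<^sub>C z"] by simp
  moreover have "(norm w)\<^sup>2 \<le> (norm (w - c *\<^sub>C z))\<^sup>2"
    using assms by (intro power_mono) auto
  ultimately have "2 * t * \<alpha> \<le> t\<^sup>2 * \<alpha> * (norm z)\<^sup>2"
    by linarith
  also have "\<dots> = (t * \<alpha>) * (t * (norm z)\<^sup>2)"
    by (simp add: power2_eq_square)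
  also have "\<dots> \<le> (t * \<alpha>) * 1"
    using pos by (intro mult_left_mono) (auto simp: t_def \<alpha>_def divide_simps)
  finally have "t * \<alpha> \<le> 0" by linarith
  then have "\<alpha> \<le> 0"
    using pos by (simp add: t_def mult_le_0_iff divide_le_0_iff)
  then show ?thesis
    by (simp add: \<alpha>_def)
qed

text \<open>A minimising sequence for the distance from \<open>y\<close> to \<open>M\<close> is Cauchy: midpoints stay in \<open>M\<close>, so the
parallelogram law bounds the gap between two members by their excess over the infimum. Its limit
is a nearest point, and a nearest point leaves an orthogonal remainder.\<close>

lemma orthogonal_projection_exists:
  fixes M :: "'a::complex_hilbert set"
  assumes M: "csubspace M" and "closed M"
  shows "\<exists>m\<in>M. \<forall>z\<in>M. cinner z (y - m) = 0"
proof -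
  define d where "d = (INF m\<in>M. (norm (y - m))\<^sup>2)"
  have ne: "M \<noteq> {}"
    using M by (auto simp: csubspace_def)
  have bdd: "bdd_below ((\<lambda>m. (norm (y - m))\<^sup>2) ` M)"
    by (auto intro: bdd_belowI[of _ 0])
  have d_le: "d \<le> (norm (y - m))\<^sup>2" if "m \<in> M" for m
    unfolding d_def by (rule cINF_lower[OF bdd that])
  have "\<exists>m\<in>M. (norm (y - m))\<^sup>2 < d + 1 / real (Suc n)" for n
    using cINF_less_iff[OF ne bdd, of "d + 1 / real (Suc n)"] by (simp add: d_def)
  then obtain f where f: "\<And>n. f n \<in> M" "\<And>n. (norm (y - f n))\<^sup>2 < d + 1 / real (Suc n)"
    by metis
  have gap: "(norm (f i - f j))\<^sup>2 \<le> 2 / real (Suc i) + 2 / real (Suc j)" for i j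
  proof -
    define m where "m = (1 / 2) *\<^sub>C (f i + f j)"
    have "m \<in> M"
      using M f(1) by (auto simp: csubspace_def m_def)
    have "m = (1 / 2) *\<^sub>R (f i + f j)"
      using scaleC_of_real[of "1 / 2" "f i + f j"] by (simp add: m_def)
    then have "(y - f j) + (y - f i) = 2 *\<^sub>R (y - m)"
      by (simp add: algebra_simps scaleR_2)
    then have "(norm ((y - f j) + (y - f i)))\<^sup>2 = 4 * (norm (y - m))\<^sup>2"
      by (simp add: power_mult_distrib)
    moreover have "(y - f j) - (y - f i) = f i - f j"
      by simp
    ultimately have "(norm (f i - f j))\<^sup>2 + 4 * (norm (y - m))\<^sup>2
        = 2 * (norm (y - f j))\<^sup>2 + 2 * (norm (y - f i))\<^sup>2"
      using parallelogram[of "y - f j" "y - f i"] by simp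
    then show ?thesis
      using f(2)[of i] f(2)[of j] d_le[OF \<open>m \<in> M\<close>] by simp
  qed
  have "Cauchy f"
  proof (rule metric_CauchyI)
    fix e :: real assume "0 < e"
    obtain N where N: "4 / e\<^sup>2 < real N"
      using reals_Archimedean2 by blast
    have "dist (f i) (f j) < e" if "i \<ge> N" "j \<ge> N" for i j
    proof -
      have "0 < real N"
        using N \<open>0 < e\<close> by (smt (verit) divide_pos_pos zero_less_power)
      have "2 / real (Suc i) + 2 / real (Suc j) \<le> 2 / real N + 2 / real N"
        using that \<open>0 < real N\<close> by (intro add_mono divide_left_mono) auto
      also have "\<dots> < e\<^sup>2"
        using N \<open>0 < e\<close> \<open>0 < real N\<close> by (simp add: field_simps)
      finally have "(norm (f i - f j))\<^sup>2 < e\<^sup>2"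
        using gap[of i j] by linarith
      then show ?thesis
        using \<open>0 < e\<close> by (simp add: dist_norm power_less_imp_less_base)
    qed
    then show "\<exists>N. \<forall>i\<ge>N. \<forall>j\<ge>N. dist (f i) (f j) < e"
      by blast
  qed
  then obtain m where m: "f \<longlonglongrightarrow> m"
    using Cauchy_convergent convergent_def by blast
  have "m \<in> M"
    using closed_sequentially[OF \<open>closed M\<close> _ m] f(1) by blast
  have "(\<lambda>n. (norm (y - f n))\<^sup>2) \<longlonglongrightarrow> (norm (y - m))\<^sup>2"
    by (intro tendsto_intros m)
  moreover have "(\<lambda>n. d + 1 / real (Suc n)) \<longlonglongrightarrow> d + 0"
    by (intro tendsto_intros LIMSEQ_Suc lim_1_over_n)
  ultimately have m_le: "(norm (y - m))\<^sup>2 \<le> d"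
    using f(2) by (intro LIMSEQ_le[of _ "(norm (y - m))\<^sup>2" _ d]) (auto intro: less_imp_le)
  have "cinner z (y - m) = 0" if "z \<in> M" for z
  proof (rule orthogonal_if_nearest)
    fix c
    have "m + c *\<^sub>C z \<in> M"
      using M \<open>m \<in> M\<close> that by (simp add: csubspace_def)
    then have "(norm (y - m))\<^sup>2 \<le> (norm (y - (m + c *\<^sub>C z)))\<^sup>2"
      using m_le d_le order_trans by blast
    then show "norm (y - m) \<le> norm (y - m - c *\<^sub>C z)"
      by (simp add: diff_diff_eq power2_le_iff_abs_le)
  qed
  with \<open>m \<in> M\<close> show ?thesis by blast
qed

text \<open>The representing vector spans the orthogonal complement of the kernel: for \<open>w\<close> orthogonal to the
kernel with \<open>f w \<noteq> 0\<close>, the vector \<open>f w x - f x w\<close> lies in the kernel, and pairing it with \<open>w\<close>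
gives the formula.\<close>

lemma Riesz_representation:
  fixes f :: "'a::complex_hilbert \<Rightarrow> complex"
  assumes f: "bounded_clinear f"
  shows "\<exists>v. \<forall>x. f x = cinner x v"
proof (cases "\<forall>x. f x = 0")
  case True
  then show ?thesis
    by (intro exI[of _ 0]) simp
next
  case False
  then obtain y where y: "f y \<noteq> 0" by blast
  define M where "M = {x. f x = 0}"
  have "csubspace M"
    using f by (auto simp: csubspace_def M_def bounded_clinear_zero bounded_clinear_add bounded_clinear_scaleC
        scaleC_complex_def)
  moreover have "closed M"
    unfolding M_def
    by (intro closed_Collect_eq continuous_intros
        linear_continuous_on bounded_clinear_bounded_linear f)
  ultimately obtain m where m: "m \<in> M" "\<forall>z\<in>M. cinner z (y - m) = 0"
    using orthogonal_projection_exists by blast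
  define w where "w = y - m"
  have fw: "f w \<noteq> 0"
    using y m(1) f by (simp add: w_def M_def bounded_clinear_diff)
  then have "w \<noteq> 0"
    using bounded_clinear_zero[OF f] by blast
  then have ww: "cinner w w \<noteq> 0"
    by (simp add: cinner_eq_zero_iff)
  have "f x = cinner x (cnj (f w / cinner w w) *\<^sub>C w)" for x
  proof -
    have "f w *\<^sub>C x - f x *\<^sub>C w \<in> M"
      using f by (simp add: M_def bounded_clinear_diff bounded_clinear_scaleC scaleC_complex_def)
    then have "cinner (f w *\<^sub>C x - f x *\<^sub>C w) w = 0"
      using m(2) by (simp add: w_def)
    then have "f w * cinner x w = f x * cinner w w"
      by (simp add: cinner.diff_left cinner_scaleC_left)
    then show ?thesis
      using ww by (simp add: cinner.scale_right field_simps)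
  qed
  then show ?thesis by blast
qed

lemma adjoint_exists:
  fixes T :: "'a::complex_hilbert \<Rightarrow> 'a"
  assumes T: "bounded_clinear T"
  shows "\<exists>S. bounded_clinear S \<and> (\<forall>x y. cinner (T x) y = cinner x (S y))"
proof -
  obtain K where K: "0 < K" "\<And>x. norm (T x) \<le> norm x * K"
    using bounded_linear.pos_bounded[OF bounded_clinear_bounded_linear[OF T]] by blast
  have "\<exists>v. \<forall>x. cinner (T x) y = cinner x v" for y
  proof (rule Riesz_representation)
    show "bounded_clinear (\<lambda>x. cinner (T x) y)"
    proof (rule bounded_clinearI[where K = "K * norm y"])
      fix x
      have "cmod (cinner (T x) y) \<le> norm (T x) * norm y"
        by (rule cinner_Cauchy_Schwarz)
      also have "\<dots> \<le> (norm x * K) * norm y"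
        using K by (intro mult_right_mono) auto
      finally show "cmod (cinner (T x) y) \<le> norm x * (K * norm y)"
        by (simp add: mult.assoc)
    qed (simp_all add: bounded_clinear_add bounded_clinear_scaleC T cinner_add_left
        cinner_scaleC_left scaleC_complex_def)
  qed
  then obtain S where S: "\<And>x y. cinner (T x) y = cinner x (S y)"
    by metis
  have "bounded_clinear S"
  proof (rule bounded_clinearI)
    show "S (x + y) = S x + S y" for x y
      by (rule cinner_eqI) (simp add: S[symmetric] cinner.add_right)
    show "S (c *\<^sub>C x) = c *\<^sub>C S x" for c x
      by (rule cinner_eqI) (simp add: S[symmetric] cinner.scale_right)
    show "norm (S y) \<le> norm y * K" for y
    proof (cases "S y = 0")
      case True
      then show ?thesis using K by simp
    next
      case False
      have "(norm (S y))\<^sup>2 = cmod (cinner (T (S y)) y)"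
        by (simp add: S cinner_self_norm norm_power)
      also have "\<dots> \<le> norm (T (S y)) * norm y"
        by (rule cinner_Cauchy_Schwarz)
      also have "\<dots> \<le> (norm (S y) * K) * norm y"
        using K by (intro mult_right_mono) auto
      finally show ?thesis
        using False by (simp add: power2_eq_square mult.commute mult.left_commute)
    qed
  qed
  with S show ?thesis by blast
qed

text \<open>The adjoint is a definite description; existence is Riesz representation of \<open>x \<mapsto> \<langle>T x, y\<rangle>\<close>, and
the inner product separates points.\<close>

lemma
  assumes "bounded_clinear T"
  shows bounded_clinear_hilbert_adjoint: "bounded_clinear (hilbert_adjoint T)"
    and cinner_hilbert_adjoint: "cinner (T x) y = cinner x (hilbert_adjoint T y)"
proof -
  let ?adj = "\<lambda>S. bounded_clinear S \<and> (\<forall>x y. cinner (T x) y = cinner x (S y))"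
  have "\<exists>!S. ?adj S"
  proof (rule ex_ex1I)
    show "\<exists>S. ?adj S"
      using assms by (rule adjoint_exists)
  next
    fix S S'
    assume S: "?adj S" and S': "?adj S'"
    show "S = S'"
    proof (rule ext, rule cinner_eqI)
      show "cinner x (S y) = cinner x (S' y)" for x y
        using S S' by metis
    qed
  qed
  then have adj: "?adj (hilbert_adjoint T)"
    unfolding hilbert_adjoint_def by (rule theI')
  then show "bounded_clinear (hilbert_adjoint T)"
    by (rule conjunct1)
  show "cinner (T x) y = cinner x (hilbert_adjoint T y)"
    using adj by blast
qed

section \<open>Uniform boundedness\<close>

text \<open>The Banach--Steinhaus theorem. The sets of points where the whole family is bounded by \<open>n\<close> are
closed and cover the space, so by Baire one of them contains a ball; differences of points of
that ball reach every direction.\<close>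

lemma uniform_boundedness:
  fixes F :: "('a::{real_normed_vector, complete_space} \<Rightarrow> 'b::real_normed_vector) set"
  assumes lin: "\<And>f. f \<in> F \<Longrightarrow> bounded_linear f"
    and pointwise: "\<And>x. \<exists>C. \<forall>f\<in>F. norm (f x) \<le> C"
  shows "\<exists>K\<ge>0. \<forall>f\<in>F. \<forall>x. norm (f x) \<le> K * norm x"
proof -
  define E where "E = (\<lambda>n::nat. {x. \<forall>f\<in>F. norm (f x) \<le> real n})"
  have closed: "closed (E n)" for n
  proof -
    have "E n = (\<Inter>f\<in>F. {x. norm (f x) \<le> real n})"
      by (auto simp: E_def)
    also have "closed \<dots>"
      by (intro closed_INT ballI closed_Collect_le continuous_intros linear_continuous_on lin)
    finally show ?thesis .
  qed
  have "(\<Union>n. E n) = UNIV"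
  proof -
    have "\<exists>n. x \<in> E n" for x
    proof -
      obtain C where C: "\<forall>f\<in>F. norm (f x) \<le> C" using pointwise by blast
      obtain n :: nat where "C \<le> real n" using real_arch_simple by blast
      with C have "x \<in> E n" by (auto simp: E_def intro: order_trans)
      then show ?thesis ..
    qed
    then show ?thesis by blast
  qed
  have "\<exists>n. interior (E n) \<noteq> {}"
  proof (rule ccontr)
    assume "\<nexists>n. interior (E n) \<noteq> {}"
    then have "interior (\<Union>(range E)) = {}"
      using Met_TC.metric_Baire_category_alt[of "range E"] closed
      by (auto simp: complete_UNIV)
    then show False
      using \<open>(\<Union>n. E n) = UNIV\<close> by simp
  qed
  then obtain n x0 where "x0 \<in> interior (E n)" by blast
  then obtain e where e: "0 < e" "cball x0 e \<subseteq> E n"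
    by (meson mem_interior_cball)
  have "norm (f x) \<le> (2 * real n / e) * norm x" if f: "f \<in> F" for f x
  proof (cases "x = 0")
    case True
    interpret bounded_linear f using f by (rule lin)
    show ?thesis using True zero by simp
  next
    case False
    interpret bounded_linear f using f by (rule lin)
    define u where "u = (e / norm x) *\<^sub>R x"
    have "x0 + u \<in> cball x0 e" "x0 \<in> cball x0 e"
      using e False by (auto simp: u_def dist_norm)
    then have "x0 + u \<in> E n" "x0 \<in> E n"
      using e(2) by blast+
    then have "norm (f (x0 + u)) \<le> real n" "norm (f x0) \<le> real n"
      using f by (auto simp: E_def)
    moreover have "f u = f (x0 + u) - f x0"
      by (simp add: add)
    ultimately have "norm (f u) \<le> 2 * real n"
      using norm_triangle_ineq4[of "f (x0 + u)" "f x0"] by simp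
    then show ?thesis
      using e(1) False by (simp add: u_def scaleR field_simps)
  qed
  then show ?thesis
    using e(1) by (intro exI[of _ "2 * real n / e"]) simp
qed

section \<open>Positive operators and the semi-inner product they induce\<close>

lemma positive_op_clinear: "positive_op A \<Longrightarrow> bounded_clinear A"
  by (simp add: positive_op_def)

text \<open>Real values of the quadratic form determine symmetry by polarisation: the form at \<open>x + y\<close> yields
the imaginary parts, and replacing \<open>x\<close> by \<open>\<i> x\<close> yields the real ones.\<close>

lemma positive_op_selfadjoint:
  fixes A :: "'a::complex_hilbert \<Rightarrow> 'a"
  assumes A: "positive_op A"
  shows "cinner (A x) y = cinner x (A y)"
proof -
  note lin = positive_op_clinear[OF A]
  have real: "Im (cinner (A z) z) = 0" for z
    using A by (auto simp: positive_op_def complex_nonneg_Reals_iff)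
  have swap: "Im (cinner (A x) y) = - Im (cinner (A y) x)" for x y
    using real[of "x + y"] real[of x] real[of y]
    by (simp add: bounded_clinear_add[OF lin] cinner_add_left cinner.add_right)
  have "Re (cinner (A x) y) = Re (cinner (A y) x)"
    using swap[of "\<i> *\<^sub>C x" y]
    by (simp add: bounded_clinear_scaleC[OF lin] cinner_scaleC_left cinner.scale_right)
  then have "cinner (A x) y = cnj (cinner (A y) x)"
    using swap[of x y] by (simp add: complex_eq_iff)
  then show ?thesis
    using cinner_commute[of x "A y"] by simp
qed

lemma semi_inner_A_inner:
  fixes A :: "'a::complex_hilbert \<Rightarrow> 'a"
  assumes A: "positive_op A"
  shows "semi_inner (A_inner A)"
proof
  note lin = positive_op_clinear[OF A]
  fix x y z :: 'a and c :: complex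
  show "A_inner A (x + y) z = A_inner A x z + A_inner A y z"
    by (simp add: A_inner_def bounded_clinear_add[OF lin] cinner_add_left)
  show "A_inner A (c *\<^sub>C x) y = c * A_inner A x y"
    by (simp add: A_inner_def bounded_clinear_scaleC[OF lin] cinner_scaleC_left)
  show "A_inner A x y = cnj (A_inner A y x)"
    unfolding A_inner_def
    by (metis positive_op_selfadjoint[OF A] cinner_commute)
  show "0 \<le> Re (A_inner A x x)"
    using A by (auto simp: A_inner_def positive_op_def complex_nonneg_Reals_iff)
qed

lemma seminorm_A_inner: "positive_op A \<Longrightarrow> semi_inner.seminorm (A_inner A) = A_seminorm A"
  by (rule ext) (simp add: semi_inner.seminorm_def[OF semi_inner_A_inner] A_seminorm_def)

lemma A_seminorm_le_norm:
  fixes A :: "'a::complex_hilbert \<Rightarrow> 'a"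
  assumes A: "positive_op A"
  shows "\<exists>c. \<forall>x. A_seminorm A x \<le> c * norm x"
proof -
  obtain K where K: "0 < K" "\<And>x. norm (A x) \<le> norm x * K"
    using bounded_linear.pos_bounded bounded_clinear_bounded_linear positive_op_clinear A by metis
  have "A_seminorm A x \<le> sqrt K * norm x" for x
  proof -
    have "Re (A_inner A x x) \<le> norm (A x) * norm x"
      unfolding A_inner_def using complex_Re_le_cmod cinner_Cauchy_Schwarz order_trans by blast
    also have "\<dots> \<le> (norm x * K) * norm x"
      using K by (intro mult_right_mono) auto
    finally have "Re (A_inner A x x) \<le> K * (norm x)\<^sup>2"
      by (simp add: power2_eq_square mult.commute mult.left_commute)
    then have "A_seminorm A x \<le> sqrt (K * (norm x)\<^sup>2)"
      unfolding A_seminorm_def by (rule real_sqrt_le_mono)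
    then show ?thesis by (simp add: real_sqrt_mult)
  qed
  then show ?thesis by blast
qed

section \<open>The distinguished adjoint with respect to a positive operator\<close>

lemma csubspace_closure_range:
  fixes A :: "'a::complex_inner \<Rightarrow> 'b::complex_inner"
  assumes A: "bounded_clinear A"
  shows "csubspace (closure (range A))"
  unfolding csubspace_def
proof (intro conjI ballI allI)
  show "0 \<in> closure (range A)"
    using closure_subset[of "range A"] bounded_clinear_zero[OF A] by (metis rangeI subsetD)
  fix x assume "x \<in> closure (range A)"
  then obtain f where f: "\<And>n. f n \<in> range A" "f \<longlonglongrightarrow> x"
    by (auto simp: closure_sequential)
  show "x + y \<in> closure (range A)" if "y \<in> closure (range A)" for y
  proof -
    obtain g where g: "\<And>n. g n \<in> range A" "g \<longlonglongrightarrow> y"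
      using \<open>y \<in> closure (range A)\<close> by (auto simp: closure_sequential)
    have "f n + g n \<in> range A" for n
      using f(1)[of n] g(1)[of n] bounded_clinear_add[OF A, symmetric] by (auto simp: image_def)
    moreover have "(\<lambda>n. f n + g n) \<longlonglongrightarrow> x + y"
      by (intro tendsto_intros f g)
    ultimately show ?thesis
      unfolding closure_sequential by (intro exI[of _ "\<lambda>n. f n + g n"] conjI allI)
  qed
  show "c *\<^sub>C x \<in> closure (range A)" for c
  proof -
    have "c *\<^sub>C f n \<in> range A" for n
      using f(1)[of n] bounded_clinear_scaleC[OF A, symmetric] by (auto simp: image_def)
    moreover have "bounded_linear (\<lambda>z :: 'b. c *\<^sub>C z)"
    proof (rule bounded_linear_intro[where K = "cmod c"])
      show "c *\<^sub>C (r *\<^sub>R z) = r *\<^sub>R (c *\<^sub>C z)" for r and z :: 'b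
        by (metis scaleC_of_real scaleC_scaleC mult.commute)
    qed (simp_all add: scaleC_add_right norm_scaleC mult.commute)
    then have "(\<lambda>n. c *\<^sub>C f n) \<longlonglongrightarrow> c *\<^sub>C x"
      by (rule bounded_linear.tendsto) (rule f)
    ultimately show ?thesis
      unfolding closure_sequential by (intro exI[of _ "\<lambda>n. c *\<^sub>C f n"] conjI allI)
  qed
qed

lemma orthogonal_closure:
  fixes v :: "'a::complex_inner"
  assumes orth: "\<And>z. z \<in> S \<Longrightarrow> cinner z v = 0" and "u \<in> closure S"
  shows "cinner u v = 0"
proof -
  obtain f where f: "\<And>n. f n \<in> S" "f \<longlonglongrightarrow> u"
    using \<open>u \<in> closure S\<close> by (auto simp: closure_sequential)
  have "(\<lambda>n. cinner (f n) v) \<longlonglongrightarrow> cinner u v"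
    by (rule bounded_linear.tendsto[OF bounded_linear_cinner_left f(2)])
  then show ?thesis
    by (simp add: orth f(1) LIMSEQ_const_iff)
qed

text \<open>A self-adjoint operator has a kernel orthogonal to its range, so \<open>A\<close> is injective on the closure
of its range. This makes solutions of \<open>A X = T\<^sup>* A\<close> with values in that closure unique.\<close>

lemma kernel_meets_closure_range_trivially:
  fixes A :: "'a::complex_hilbert \<Rightarrow> 'a"
  assumes A: "positive_op A" and "u \<in> closure (range A)" "v \<in> closure (range A)" "A u = A v"
  shows "u = v"
proof -
  have "cinner z (u - v) = 0" if "z \<in> range A" for z
  proof -
    obtain w where "z = A w" using \<open>z \<in> range A\<close> by blast
    then show ?thesis
      using \<open>A u = A v\<close> positive_op_clinear[OF A]
      by (simp add: positive_op_selfadjoint[OF A] bounded_clinear_diff)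
  qed
  moreover have "u - v \<in> closure (range A)"
    using assms csubspace_diff[OF csubspace_closure_range[OF positive_op_clinear[OF A]]] by blast
  ultimately have "cinner (u - v) (u - v) = 0"
    by (rule orthogonal_closure)
  then show ?thesis
    by (simp add: cinner_eq_zero_iff)
qed

text \<open>The component of \<open>y\<close> orthogonal to the range lies in the kernel of \<open>A\<close>, so the projection of \<open>y\<close> has
the same image.\<close>

lemma range_lift_to_closure_range:
  fixes A :: "'a::complex_hilbert \<Rightarrow> 'a"
  assumes A: "positive_op A"
  shows "\<exists>m\<in>closure (range A). A m = A y"
proof -
  note lin = positive_op_clinear[OF A]
  obtain m where m: "m \<in> closure (range A)" "\<forall>z\<in>closure (range A). cinner z (y - m) = 0"
    using orthogonal_projection_exists[OF csubspace_closure_range[OF lin] closed_closure] by blast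
  have "A (A (y - m)) \<in> closure (range A)"
    by (rule subsetD[OF closure_subset rangeI])
  then have "cinner (A (A (y - m))) (y - m) = 0"
    using m(2) by blast
  then have "A (y - m) = 0"
    by (simp add: positive_op_selfadjoint[OF A, of "A (y - m)"] cinner_eq_zero_iff)
  then show ?thesis
    using m(1) by (auto simp: bounded_clinear_diff[OF lin])
qed

text \<open>Choosing for each \<open>x\<close> the preimage of \<open>T\<^sup>* A x\<close> in the closure of the range of \<open>A\<close> defines \<open>X\<close>, and
uniqueness of the choice makes it linear. Boundedness is the one analytic point. On the range,
\<open>\<langle>A w, X x\<rangle> = \<langle>A (T w), x\<rangle>\<close>, so the functionals \<open>\<langle>A (T w), _\<rangle>\<close> with \<open>\<parallel>A w\<parallel> = 1\<close> are bounded at \<open>x\<close>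
by \<open>\<parallel>X x\<parallel>\<close>, hence uniformly bounded. The resulting estimate for \<open>\<langle>z, X x\<rangle>\<close> with \<open>z\<close> in the range
extends by continuity to \<open>z = X x\<close>.\<close>

lemma A_sharp_exists:
  fixes A T :: "'a::complex_hilbert \<Rightarrow> 'a"
  assumes A: "positive_op A" and "T \<in> A_adjointable A"
  shows "\<exists>X. bounded_clinear X \<and> A \<circ> X = hilbert_adjoint T \<circ> A \<and> range X \<subseteq> closure (range A)"
proof -
  note lin = positive_op_clinear[OF A]
  have T: "bounded_clinear T" and ran: "range (hilbert_adjoint T \<circ> A) \<subseteq> range A"
    using \<open>T \<in> A_adjointable A\<close> by (auto simp: A_adjointable_def)
  note T_adj = bounded_clinear_hilbert_adjoint[OF T]
  have "\<exists>m. m \<in> closure (range A) \<and> A m = hilbert_adjoint T (A x)" for x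
  proof -
    obtain y where "A y = hilbert_adjoint T (A x)"
      using ran by (metis comp_apply rangeE rangeI subsetD)
    then show ?thesis
      using range_lift_to_closure_range[OF A, of y] by metis
  qed
  then obtain X where X: "\<And>x. X x \<in> closure (range A)" "\<And>x. A (X x) = hilbert_adjoint T (A x)"
    by metis
  note sub = csubspace_closure_range[OF lin, unfolded csubspace_def]
  note uniq = kernel_meets_closure_range_trivially[OF A]
  have add: "X (x + y) = X x + X y" for x y
    by (rule uniq) (use X sub in \<open>simp_all add: bounded_clinear_add[OF lin] bounded_clinear_add[OF T_adj]\<close>)
  have scaleC: "X (c *\<^sub>C x) = c *\<^sub>C X x" for c x
    by (rule uniq) (use X sub in \<open>simp_all add: bounded_clinear_scaleC[OF lin] bounded_clinear_scaleC[OF T_adj]\<close>)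
  have weak: "cinner (A w) (X x) = cinner (A (T w)) x" for w x
    by (metis A X(2) T positive_op_selfadjoint cinner_hilbert_adjoint)
  define F where "F = {f. \<exists>w. norm (A w) = 1 \<and> f = cinner (A (T w))}"
  have "\<exists>K\<ge>0. \<forall>f\<in>F. \<forall>x. norm (f x) \<le> K * norm x"
  proof (rule uniform_boundedness)
    show "bounded_linear f" if "f \<in> F" for f
      using that by (auto simp: F_def bounded_linear_cinner_right)
    have "norm (f x) \<le> norm (X x)" if "f \<in> F" for f x
    proof -
      obtain w where w: "norm (A w) = 1" "f = cinner (A (T w))"
        using \<open>f \<in> F\<close> by (auto simp: F_def)
      then show ?thesis
        using cinner_Cauchy_Schwarz[of "A w" "X x"] by (simp add: weak)
    qed
    then show "\<exists>C. \<forall>f\<in>F. norm (f x) \<le> C" for x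
      by blast
  qed
  then obtain K where K: "0 \<le> K" "\<And>f x. f \<in> F \<Longrightarrow> norm (f x) \<le> K * norm x"
    by blast
  have on_range: "cmod (cinner z (X x)) \<le> K * norm x * norm z" if "z \<in> range A" for z x
  proof (cases "z = 0")
    case False
    obtain w where w: "z = A w" using \<open>z \<in> range A\<close> by blast
    define w' where "w' = complex_of_real (1 / norm z) *\<^sub>C w"
    have Aw': "A w' = complex_of_real (1 / norm z) *\<^sub>C z"
      by (simp add: w'_def w bounded_clinear_scaleC[OF lin])
    then have "norm (A w') = 1"
      using False by (simp add: norm_scaleC norm_divide)
    then have "cmod (cinner (A (T w')) x) \<le> K * norm x"
      by (intro K(2)) (auto simp: F_def)
    then have "cmod (cinner (A w') (X x)) \<le> K * norm x"
      by (simp add: weak)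
    then show ?thesis
      using False by (simp add: Aw' cinner_scaleC_left norm_mult norm_divide field_simps)
  qed simp
  have bound: "norm (X x) \<le> norm x * K" for x
  proof (cases "X x = 0")
    case True
    then show ?thesis using K(1) by simp
  next
    case False
    obtain f where f: "\<And>n. f n \<in> range A" "f \<longlonglongrightarrow> X x"
      using X(1)[of x] by (auto simp: closure_sequential)
    have "(\<lambda>n. cmod (cinner (f n) (X x))) \<longlonglongrightarrow> cmod (cinner (X x) (X x))"
      by (intro tendsto_norm bounded_linear.tendsto[OF bounded_linear_cinner_left f(2)])
    moreover have "(\<lambda>n. K * norm x * norm (f n)) \<longlonglongrightarrow> K * norm x * norm (X x)"
      by (intro tendsto_intros f)
    ultimately have "cmod (cinner (X x) (X x)) \<le> K * norm x * norm (X x)"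
      by (rule LIMSEQ_le) (use on_range f(1) in blast)
    then show ?thesis
      using False by (simp add: cinner_self_norm norm_power power2_eq_square norm_mult mult.commute)
  qed
  have "bounded_clinear X"
    by (rule bounded_clinearI[OF add scaleC bound])
  with X show ?thesis
    by (intro exI[of _ X]) auto
qed

lemma
  fixes A T :: "'a::complex_hilbert \<Rightarrow> 'a"
  assumes A: "positive_op A" and "T \<in> A_adjointable A"
  shows bounded_clinear_A_sharp: "bounded_clinear (A_sharp A T)"
    and A_inner_A_sharp: "A_inner A (T x) y = A_inner A x (A_sharp A T y)"
proof -
  let ?sharp = "\<lambda>X. bounded_clinear X \<and> A \<circ> X = hilbert_adjoint T \<circ> A
      \<and> range X \<subseteq> closure (range A)"
  have "\<exists>!X. ?sharp X"
  proof (rule ex_ex1I)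
    show "\<exists>X. ?sharp X"
      using assms by (rule A_sharp_exists)
  next
    fix X Y
    assume X: "?sharp X" and Y: "?sharp Y"
    show "X = Y"
    proof
      fix x
      show "X x = Y x"
      proof (rule kernel_meets_closure_range_trivially[OF A])
        show "X x \<in> closure (range A)" "Y x \<in> closure (range A)"
          using X Y by (meson rangeI subsetD)+
        show "A (X x) = A (Y x)"
          using X Y by (simp add: fun_eq_iff)
      qed
    qed
  qed
  then have sharp: "?sharp (A_sharp A T)"
    unfolding A_sharp_def by (rule theI')
  then show "bounded_clinear (A_sharp A T)"
    by (rule conjunct1)
  have T: "bounded_clinear T"
    using assms(2) by (simp add: A_adjointable_def)
  have A_sharp_eq: "A (A_sharp A T y) = hilbert_adjoint T (A y)"
    using sharp by (simp add: fun_eq_iff)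
  show "A_inner A (T x) y = A_inner A x (A_sharp A T y)"
    by (simp add: A_inner_def positive_op_selfadjoint[OF A] cinner_hilbert_adjoint[OF T] A_sharp_eq)
qed

section \<open>Operator seminorms and the numerical range of one row\<close>

text \<open>A real supremum says nothing unless the set is bounded above; the adjoint \<open>T'\<close> guarantees that it is.\<close>

lemma
  fixes A T T' :: "'a::complex_hilbert \<Rightarrow> 'a"
  assumes A: "positive_op A" and T: "bounded_linear T" and T': "bounded_linear T'"
    and adj: "\<And>x y. A_inner A (T x) y = A_inner A x (T' y)"
  shows A_seminorm_le_A_opnorm: "A_seminorm A (T x) \<le> A_opnorm A T * A_seminorm A x"
    and A_opnorm_nonneg: "0 \<le> A_opnorm A T"
proof -
  interpret semi_inner "A_inner A"
    using A by (rule semi_inner_A_inner)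
  note seminorm = seminorm_A_inner[OF A]
  obtain c where c: "\<And>x. A_seminorm A x \<le> c * norm x"
    using A_seminorm_le_norm[OF A] by blast
  obtain K where K: "0 \<le> K" "\<And>x. A_seminorm A (T x) \<le> K * A_seminorm A x"
    using adjoint_pair_bounded[of T T' c] adj T T' c by (auto simp: seminorm)
  have bdd: "bdd_above (insert 0 {A_seminorm A (T x) | x. A_seminorm A x = 1})"
  proof (rule bdd_aboveI)
    show "r \<le> K" if "r \<in> insert 0 {A_seminorm A (T x) | x. A_seminorm A x = 1}" for r
      using that K(1) K(2) by (auto, metis mult.right_neutral)
  qed
  show "0 \<le> A_opnorm A T"
    unfolding A_opnorm_def using bdd by (intro cSup_upper) auto
  show "A_seminorm A (T x) \<le> A_opnorm A T * A_seminorm A x"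
  proof (rule le_by_homogeneity[unfolded seminorm])
    show "T (r *\<^sub>R x) = r *\<^sub>R T x" for r x
      using T by (simp add: linear_simps)
    show "A_seminorm A (T x) \<le> A_opnorm A T" if "A_seminorm A x = 1" for x
      unfolding A_opnorm_def using bdd that by (intro cSup_upper) auto
    show "A_seminorm A (T x) = 0" if "A_seminorm A x = 0" for x
      using K(2)[of x] that seminorm_nonneg[of "T x"] by (simp add: seminorm)
  qed
qed

text \<open>The right-hand factor \<open>(p + sqrt (p\<^sup>2 + q\<^sup>2)) / 2\<close> is the largest eigenvalue of the symmetric matrix
with diagonal \<open>(p, 0)\<close> and off-diagonal entries \<open>q / 2\<close>. In the coordinates \<open>x\<^sup>2 - y\<^sup>2\<close>, \<open>2 x y\<close>, whose
squares add up to \<open>(x\<^sup>2 + y\<^sup>2)\<^sup>2\<close>, this is the Cauchy--Schwarz inequality in the plane.\<close>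

lemma quadratic_form_bound:
  fixes p q x y :: real
  shows "p * x\<^sup>2 + q * x * y \<le> 1 / 2 * (p + sqrt (p\<^sup>2 + q\<^sup>2)) * (x\<^sup>2 + y\<^sup>2)"
proof -
  have "(p * (x\<^sup>2 - y\<^sup>2) + q * (2 * x * y))\<^sup>2
      \<le> (p\<^sup>2 + q\<^sup>2) * ((x\<^sup>2 - y\<^sup>2)\<^sup>2 + (2 * x * y)\<^sup>2)"
    using zero_le_power2[of "p * (2 * x * y) - q * (x\<^sup>2 - y\<^sup>2)"]
    by (simp add: power2_eq_square algebra_simps)
  also have "(x\<^sup>2 - y\<^sup>2)\<^sup>2 + (2 * x * y)\<^sup>2 = (x\<^sup>2 + y\<^sup>2)\<^sup>2"
    by (simp add: power2_eq_square algebra_simps)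
  finally have "p * (x\<^sup>2 - y\<^sup>2) + q * (2 * x * y) \<le> sqrt ((p\<^sup>2 + q\<^sup>2) * (x\<^sup>2 + y\<^sup>2)\<^sup>2)"
    by (rule real_le_rsqrt)
  then have "p * (x\<^sup>2 - y\<^sup>2) + q * (2 * x * y) \<le> sqrt (p\<^sup>2 + q\<^sup>2) * (x\<^sup>2 + y\<^sup>2)"
    by (simp add: real_sqrt_mult)
  then show ?thesis
    by (simp add: field_simps)
qed

text \<open>For \<open>\<parallel>u\<parallel> \<noteq> 0\<close> put \<open>p' = |\<langle>P u, u\<rangle>| / \<parallel>u\<parallel>\<^sup>2\<close> and \<open>q = \<parallel>Q' u\<parallel> / \<parallel>u\<parallel>\<close>. The left-hand side is at most
\<open>p' \<parallel>u\<parallel>\<^sup>2 + q \<parallel>u\<parallel> \<parallel>v\<parallel>\<close>. The number \<open>p'\<close> is bounded in two ways: by \<open>p\<close>, and by \<open>\<parallel>P' u\<parallel> / \<parallel>u\<parallel>\<close>. The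
second bound makes \<open>p'\<^sup>2 + q\<^sup>2 \<le> N\<close>, because \<open>\<parallel>P' u\<parallel>\<^sup>2 + \<parallel>Q' u\<parallel>\<^sup>2 = \<langle>(P P' + Q Q') u, u\<rangle>\<close>. The same
identity gives \<open>\<parallel>Q' u\<parallel> = 0\<close> when \<open>\<parallel>u\<parallel> = 0\<close>, so that the left-hand side is then \<open>0\<close>.\<close>

lemma (in semi_inner) row_numerical_bound:
  fixes P P' Q Q' :: "'a \<Rightarrow> 'a"
  assumes adjP: "\<And>x y. s (P x) y = s x (P' y)"
    and adjQ: "\<And>x y. s (Q x) y = s x (Q' y)"
    and p: "0 \<le> p" "seminorm (P u) \<le> p * seminorm u"
    and N: "0 \<le> N" "seminorm (P (P' u) + Q (Q' u)) \<le> N * seminorm u"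
  shows "cmod (s (P u + Q v) u) \<le> 1 / 2 * (p + sqrt N) * ((seminorm u)\<^sup>2 + (seminorm v)\<^sup>2)"
proof -
  define w \<beta> where "w = cmod (s (P u) u)" and "\<beta> = seminorm (Q' u)"
  have "(seminorm (P' u))\<^sup>2 + \<beta>\<^sup>2 = Re (s (P (P' u) + Q (Q' u)) u)"
    by (simp add: \<beta>_def seminorm_power2 add_left adjP adjQ)
  also have "\<dots> \<le> seminorm (P (P' u) + Q (Q' u)) * seminorm u"
    using complex_Re_le_cmod Cauchy_Schwarz by (rule order_trans)
  also have "\<dots> \<le> (N * seminorm u) * seminorm u"
    using N by (intro mult_right_mono) auto
  finally have adj_sum: "(seminorm (P' u))\<^sup>2 + \<beta>\<^sup>2 \<le> N * (seminorm u)\<^sup>2"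
    by (simp add: power2_eq_square mult.assoc)
  have w_P: "w \<le> p * (seminorm u)\<^sup>2"
    using Cauchy_Schwarz[of "P u" u] mult_right_mono[OF p(2) seminorm_nonneg[of u]]
    by (simp add: w_def power2_eq_square mult.assoc)
  have w_P': "w\<^sup>2 \<le> (seminorm u)\<^sup>2 * (seminorm (P' u))\<^sup>2"
    unfolding power_mult_distrib[symmetric]
    using Cauchy_Schwarz[of u "P' u"] by (intro power_mono) (simp_all add: w_def adjP)
  have "cmod (s (P u + Q v) u) \<le> w + cmod (s (Q v) u)"
    unfolding add_left w_def by (rule norm_triangle_ineq)
  also have "cmod (s (Q v) u) \<le> seminorm v * \<beta>"
    using Cauchy_Schwarz[of v "Q' u"] by (simp add: adjQ \<beta>_def)
  finally have split: "cmod (s (P u + Q v) u) \<le> w + seminorm v * \<beta>"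
    by simp
  show ?thesis
  proof (cases "seminorm u = 0")
    case True
    then have "w \<le> 0" "\<beta> = 0"
      using w_P adj_sum by (simp_all add: sum_power2_le_zero_iff)
    then have "cmod (s (P u + Q v) u) \<le> 0"
      using split by (simp only: mult_zero_right add_0_right)
    also have "0 \<le> 1 / 2 * (p + sqrt N) * ((seminorm u)\<^sup>2 + (seminorm v)\<^sup>2)"
      using p N by (intro mult_nonneg_nonneg add_nonneg_nonneg) auto
    finally show ?thesis .
  next
    case False
    define p' q where "p' = w / (seminorm u)\<^sup>2" and "q = \<beta> / seminorm u"
    have pos: "0 < (seminorm u)\<^sup>2"
      using False by simp
    have "p' \<le> p"
      using w_P pos by (simp add: p'_def divide_le_eq)
    have "p'\<^sup>2 \<le> (seminorm (P' u))\<^sup>2 / (seminorm u)\<^sup>2"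
      using w_P' pos by (simp add: p'_def power_divide divide_simps power2_eq_square mult_ac)
    then have "p'\<^sup>2 + q\<^sup>2 \<le> ((seminorm (P' u))\<^sup>2 + \<beta>\<^sup>2) / (seminorm u)\<^sup>2"
      by (simp add: q_def power_divide add_divide_distrib)
    also have "\<dots> \<le> N"
      using adj_sum pos by (simp add: divide_le_eq)
    finally have "sqrt (p'\<^sup>2 + q\<^sup>2) \<le> sqrt N"
      by simp
    have "w + seminorm v * \<beta> = p' * (seminorm u)\<^sup>2 + q * seminorm u * seminorm v"
      using False by (simp add: p'_def q_def)
    also have "\<dots> \<le> 1 / 2 * (p' + sqrt (p'\<^sup>2 + q\<^sup>2)) * ((seminorm u)\<^sup>2 + (seminorm v)\<^sup>2)"
      by (rule quadratic_form_bound)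
    also have "\<dots> \<le> 1 / 2 * (p + sqrt N) * ((seminorm u)\<^sup>2 + (seminorm v)\<^sup>2)"
      using \<open>p' \<le> p\<close> \<open>sqrt (p'\<^sup>2 + q\<^sup>2) \<le> sqrt N\<close>
      by (intro mult_right_mono mult_left_mono add_mono add_nonneg_nonneg) auto
    finally show ?thesis
      using split by simp
  qed
qed

lemma
  fixes A P Q :: "'a::complex_hilbert \<Rightarrow> 'a"
  assumes A: "positive_op A" and P: "P \<in> A_adjointable A" and Q: "Q \<in> A_adjointable A"
  shows A_row_numerical_bound: "cmod (A_inner A (P u + Q v) u)
    \<le> 1 / 2 * (A_opnorm A P + sqrt (A_opnorm A (\<lambda>x. P (A_sharp A P x) + Q (A_sharp A Q x))))
        * ((A_seminorm A u)\<^sup>2 + (A_seminorm A v)\<^sup>2)"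
    and A_row_bound_nonneg: "0 \<le> A_opnorm A P
      + sqrt (A_opnorm A (\<lambda>x. P (A_sharp A P x) + Q (A_sharp A Q x)))"
proof -
  interpret semi_inner "A_inner A"
    using A by (rule semi_inner_A_inner)
  note seminorm = seminorm_A_inner[OF A]
  note adjP = A_inner_A_sharp[OF A P] and adjQ = A_inner_A_sharp[OF A Q]
  have lin: "bounded_linear P" "bounded_linear Q"
    "bounded_linear (A_sharp A P)" "bounded_linear (A_sharp A Q)"
    using P Q bounded_clinear_A_sharp[OF A P] bounded_clinear_A_sharp[OF A Q]
    by (auto simp: A_adjointable_def bounded_clinear_bounded_linear)
  define H where "H = (\<lambda>x. P (A_sharp A P x) + Q (A_sharp A Q x))"
  have H_lin: "bounded_linear H"
    unfolding H_def by (intro bounded_linear_add bounded_linear_compose[OF lin(1) lin(3)]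
        bounded_linear_compose[OF lin(2) lin(4)])
  have adjP': "A_inner A (A_sharp A P x) y = A_inner A x (P y)" for x y
    by (metis adjP commute)
  have adjQ': "A_inner A (A_sharp A Q x) y = A_inner A x (Q y)" for x y
    by (metis adjQ commute)
  \<comment> \<open>Being its own adjoint for the form, the operator under the root has a bounded operator seminorm.\<close>
  have H_adj: "A_inner A (H x) y = A_inner A x (H y)" for x y
    by (simp add: H_def add_left add_right adjP adjQ adjP' adjQ')
  have P_nonneg: "0 \<le> A_opnorm A P" and H_nonneg: "0 \<le> A_opnorm A H"
    using A_opnorm_nonneg[OF A lin(1,3) adjP] A_opnorm_nonneg[OF A H_lin H_lin H_adj] by auto
  show "0 \<le> A_opnorm A P + sqrt (A_opnorm A (\<lambda>x. P (A_sharp A P x) + Q (A_sharp A Q x)))"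
    using P_nonneg H_nonneg by (simp add: H_def)
  show "cmod (A_inner A (P u + Q v) u)
    \<le> 1 / 2 * (A_opnorm A P + sqrt (A_opnorm A (\<lambda>x. P (A_sharp A P x) + Q (A_sharp A Q x))))
        * ((A_seminorm A u)\<^sup>2 + (A_seminorm A v)\<^sup>2)"
    unfolding H_def[symmetric] seminorm[symmetric]
  proof (rule row_numerical_bound[OF adjP adjQ P_nonneg _ H_nonneg])
    show "seminorm (P u) \<le> A_opnorm A P * seminorm u"
      using A_seminorm_le_A_opnorm[OF A lin(1,3) adjP] by (simp add: seminorm)
    show "seminorm (P (A_sharp A P u) + Q (A_sharp A Q u)) \<le> A_opnorm A H * seminorm u"
      using A_seminorm_le_A_opnorm[OF A H_lin H_lin H_adj, of u] by (simp add: seminorm H_def)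
  qed
qed

section \<open>The bound for the operator matrix\<close>

lemma A_inner_diagonal:
  "A_inner (op_matrix A (\<lambda>_. 0) (\<lambda>_. 0) A) x y
    = A_inner A (fst x) (fst y) + A_inner A (snd x) (snd y)"
  by (simp add: A_inner_def op_matrix_def cinner_prod_def split_beta)

theorem theorem2p3:
  fixes A P Q R S :: "'a::complex_hilbert \<Rightarrow> 'a"
  assumes "positive_op A"
    and "P \<in> A_adjointable A" and "Q \<in> A_adjointable A"
    and "R \<in> A_adjointable A" and "S \<in> A_adjointable A"
  shows "A_numerical_radius (op_matrix A (\<lambda>_. 0) (\<lambda>_. 0) A) (op_matrix P Q R S)
    \<le> 1 / 2 * (A_opnorm A P + A_opnorm A S
        + sqrt (A_opnorm A (\<lambda>x. P (A_sharp A P x) + Q (A_sharp A Q x)))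
        + sqrt (A_opnorm A (\<lambda>x. R (A_sharp A R x) + S (A_sharp A S x))))"
proof -
  note A = assms(1)
  interpret semi_inner "A_inner A"
    using A by (rule semi_inner_A_inner)
  let ?AA = "op_matrix A (\<lambda>_. 0) (\<lambda>_. 0) A" and ?T = "op_matrix P Q R S"
  define k\<^sub>1 where "k\<^sub>1 = 1 / 2 * (A_opnorm A P
    + sqrt (A_opnorm A (\<lambda>x. P (A_sharp A P x) + Q (A_sharp A Q x))))"
  define k\<^sub>2 where "k\<^sub>2 = 1 / 2 * (A_opnorm A S
    + sqrt (A_opnorm A (\<lambda>x. R (A_sharp A R x) + S (A_sharp A S x))))"
  have bound: "cmod (A_inner ?AA (?T x) x) \<le> k\<^sub>1 + k\<^sub>2" if "A_seminorm ?AA x = 1" for x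
  proof -
    obtain u v where x: "x = (u, v)" by fastforce
    have "Re (A_inner A u u) + Re (A_inner A v v) = 1"
      using that by (simp add: x A_seminorm_def A_inner_diagonal)
    then have unit: "(A_seminorm A u)\<^sup>2 + (A_seminorm A v)\<^sup>2 = 1"
      by (simp add: seminorm_power2 flip: seminorm_A_inner[OF A])
    have "cmod (A_inner A (P u + Q v) u) \<le> k\<^sub>1"
      using A_row_numerical_bound[OF A assms(2,3), of u v] unit by (simp add: k\<^sub>1_def)
    \<comment> \<open>The second row is a first row for the exchanged summands, with \<open>S\<close> on the diagonal.\<close>
    moreover have "cmod (A_inner A (R u + S v) v) \<le> k\<^sub>2"
      using A_row_numerical_bound[OF A assms(5,4), of v u] unit
      by (simp add: k\<^sub>2_def add.commute)
    moreover have "A_inner ?AA (?T x) x = A_inner A (P u + Q v) u + A_inner A (R u + S v) v"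
      unfolding A_inner_diagonal by (simp add: x op_matrix_def)
    ultimately show ?thesis
      using norm_triangle_mono by metis
  qed
  have "0 \<le> k\<^sub>1 + k\<^sub>2"
    using A_row_bound_nonneg[OF A assms(2,3)] A_row_bound_nonneg[OF A assms(5,4)]
    by (simp add: k\<^sub>1_def k\<^sub>2_def add.commute)
  have "A_numerical_radius ?AA ?T \<le> k\<^sub>1 + k\<^sub>2"
    unfolding A_numerical_radius_def
    using bound \<open>0 \<le> k\<^sub>1 + k\<^sub>2\<close> by (intro cSup_least) auto
  then show ?thesis
    by (simp add: k\<^sub>1_def k\<^sub>2_def algebra_simps)
qed

end
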